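(* Let $L$ be a Fomin lattice with value set $V$, differential degree $r$ and weighting $w$, and suppose $L=L_1\times L_2$ is a cartesian product of two lattices. Then there exist $r_1,r_2\in V$ and weightings $w_1$ on the coverings of $L_1$ and $w_2$ on the coverings of $L_2$ (with values in $V$) such that: (1) $L_1$ is a Fomin lattice with differential degree $r_1$ and weighting $w_1$; (2) $L_2$ is a Fomin lattice with differential degree $r_2$ and weighting $w_2$; (3) $r=r_1+r_2$; (4) for every covering $x\lessdot y$ in $L_1$ and every $z\in L_2$, $w((x,z)\lessdot(y,z))=w_1(x\lessdot y)$; (5) for every $v\in L_1$ and every covering $x\lessdot y$ in $L_2$, $w((v,x)\lessdot(v,y))=w_2(x\lessdot y)$.
   Context: A Fomin lattice consists of: a lattice $L$ that is modular, locally finite, and in which every element has finitely many upper covers and finitely many lower covers; a module $V$ (the set of values) over a unital ring; an element $r\in V$ (the differential degree); and a function $w$ assigning to every covering $x\lessdot y$ of $L$ a value $w(x\lessdot y)\in V$, such that (a) for all $x\in L$, $\sum_{y\lessdot x} w(y\lessdot x)+r=\sum_{x\lessdot z}w(x\lessdot z)$, and (b) $w$ is projective-constant: whenever $x\vee y$ covers both $x$ and $y$ and $x\wedge y$ is covered by both $x$ and $y$, then $w(x\wedge y\lessdot x)=w(y\lessdot x\vee y)$ and $w(x\wedge y\lessdot y)=w(x\lessdot x\vee y)$. *)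

theory Defs
  imports Complex_Main "HOL-Library.Product_Order"
begin

definition covered_by :: "'l::order \<Rightarrow> 'l \<Rightarrow> bool" (infix "\<lessdot>" 50)
  where "x \<lessdot> y \<longleftrightarrow> x < y \<and> \<not> (\<exists>z. x < z \<and> z < y)"

definition modular_lattice :: "'l::lattice itself \<Rightarrow> bool"
  where "modular_lattice _ \<longleftrightarrow> (\<forall>x y z :: 'l. x \<le> z \<longrightarrow> sup x (inf y z) = inf (sup x y) z)"

definition locally_finite :: "'l::order itself \<Rightarrow> bool"
  where "locally_finite _ \<longleftrightarrow> (\<forall>x y :: 'l. finite {x..y})"

definition finite_covers :: "'l::order itself \<Rightarrow> bool"
  where "finite_covers _ \<longleftrightarrow> (\<forall>x :: 'l. finite {z. x \<lessdot> z} \<and> finite {y. y \<lessdot> x})"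

text \<open>
  A weighting is a total function of two arguments; only its values on pairs
  \<open>x \<lessdot> y\<close> are meaningful, and all other values are ignored.
\<close>

definition projective_constant :: "('l::lattice \<Rightarrow> 'l \<Rightarrow> 'v) \<Rightarrow> bool"
  where "projective_constant w \<longleftrightarrow>
    (\<forall>x y. x \<lessdot> sup x y \<and> y \<lessdot> sup x y \<and> inf x y \<lessdot> x \<and> inf x y \<lessdot> y \<longrightarrow>
       w (inf x y) x = w y (sup x y) \<and> w (inf x y) y = w x (sup x y))"

text \<open>
  The library's locale \<^locale>\<open>module\<close> requires commutative scalars with \<open>0 \<noteq> 1\<close>; here the
  scalars form an arbitrary unital ring.
\<close>

locale left_module =
  fixes scale :: "'r::{ring,monoid_mult} \<Rightarrow> 'v::ab_group_add \<Rightarrow> 'v"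
  assumes scale_right_distrib: "scale a (u + v) = scale a u + scale a v"
    and scale_left_distrib: "scale (a + b) v = scale a v + scale b v"
    and scale_scale: "scale a (scale b v) = scale (a * b) v"
    and scale_one: "scale 1 v = v"

text \<open>
  The underlying lattice is the type \<open>'l\<close> with its class operations; the value module is the
  type \<open>'v\<close> with scalar multiplication \<open>scale\<close>.
\<close>

locale fomin_lattice = left_module scale
  for scale :: "'r::{ring,monoid_mult} \<Rightarrow> 'v::ab_group_add \<Rightarrow> 'v" +
  fixes r :: 'v
    and w :: "'l::lattice \<Rightarrow> 'l \<Rightarrow> 'v"
  assumes modular: "modular_lattice TYPE('l)"
    and locally_finite: "locally_finite TYPE('l)"
    and finite_covers: "finite_covers TYPE('l)"
    and differential: "\<And>x. (\<Sum>y | y \<lessdot> x. w y x) + r = (\<Sum>z | x \<lessdot> z. w x z)"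
    and projective_constant: "projective_constant w"

end

theory Submission
  imports Defs
begin

text \<open>
  A covering of one factor and a covering of the other span a projective square in the product,
  so the weight of a covering of one factor is unchanged when the fixed coordinate moves along a
  covering. Locally finite lattices are connected by coverings, so the weight does not depend on
  the fixed coordinate at all. The differential condition then reads \<open>D\<^sub>1 x + D\<^sub>2 z = r\<close> with
  \<open>D\<^sub>i\<close> the excess of upper over lower weights in the \<open>i\<close>-th factor, whence \<open>D\<^sub>1\<close> and \<open>D\<^sub>2\<close>
  are constant.
\<close>

lemma covered_by_Pair_iff:
  fixes a c :: "'a::order" and b d :: "'b::order"
  shows "(a, b) \<lessdot> (c, d) \<longleftrightarrow> a \<lessdot> c \<and> b = d \<or> a = c \<and> b \<lessdot> d"
proof
  assume cov: "(a, b) \<lessdot> (c, d)"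
  then have le: "a \<le> c" "b \<le> d" and ne: "a \<noteq> c \<or> b \<noteq> d"
    and nb: "\<And>u v. (a, b) < (u, v) \<Longrightarrow> \<not> (u, v) < (c, d)"
    unfolding covered_by_def by (auto simp: less_le)
  \<comment> \<open>The corner \<open>(c, b)\<close> lies between \<open>(a, b)\<close> and
    \<open>(c, d)\<close>. As it cannot lie strictly between, it equals one of the two.\<close>
  from nb[of c b] le have "a = c \<or> b = d"
    by (auto simp: less_le)
  then show "a \<lessdot> c \<and> b = d \<or> a = c \<and> b \<lessdot> d"
  proof
    assume [simp]: "a = c"
    have "\<not> (b < z \<and> z < d)" for z
      using nb[of c z] by (auto simp: less_le)
    then show ?thesis using le ne by (auto simp: covered_by_def less_le)
  next
    assume [simp]: "b = d"
    have "\<not> (a < z \<and> z < c)" for z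
      using nb[of z d] by (auto simp: less_le)
    then show ?thesis using le ne by (auto simp: covered_by_def less_le)
  qed
next
  assume "a \<lessdot> c \<and> b = d \<or> a = c \<and> b \<lessdot> d"
  then show "(a, b) \<lessdot> (c, d)"
    unfolding covered_by_def less_le by fastforce
qed

lemma covered_by_irrefl: "\<not> x \<lessdot> x"
  by (simp add: covered_by_def)

lemma covers_Pair:
  shows upper_covers_Pair:
      "{q. (x, z) \<lessdot> q} = (\<lambda>a. (a, z)) ` {a. x \<lessdot> a} \<union> Pair x ` {b. z \<lessdot> b}"
    and lower_covers_Pair:
      "{q. q \<lessdot> (x, z)} = (\<lambda>a. (a, z)) ` {a. a \<lessdot> x} \<union> Pair x ` {b. b \<lessdot> z}"
  by (auto simp: covered_by_Pair_iff image_iff)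

text \<open>The slices could only share \<open>(x, z)\<close>, which \<open>x \<notin> A\<close>
  excludes. In the application \<open>A\<close> consists of upper or lower covers of
  \<open>x\<close>, and no element covers itself.\<close>

lemma sum_slices:
  fixes f :: "'a \<times> 'b \<Rightarrow> 'c::comm_monoid_add"
  assumes "finite A" "finite B" "x \<notin> A"
  shows "sum f ((\<lambda>a. (a, z)) ` A \<union> Pair x ` B) = (\<Sum>a\<in>A. f (a, z)) + (\<Sum>b\<in>B. f (x, b))"
  using assms
  by (subst sum.union_disjoint) (auto simp: sum.reindex inj_on_def)

text \<open>A minimal element of the finite nonempty set \<open>{x<..y}\<close> covers
  \<open>x\<close>: anything strictly between would be a smaller member of the set.\<close>

lemma locally_finite_upper_cover:
  fixes x y :: "'l::order"
  assumes "locally_finite TYPE('l)" "x < y"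
  obtains z where "x \<lessdot> z" "z \<le> y"
proof -
  have "finite {x<..y}"
    using assms(1) by (auto simp: locally_finite_def intro!: finite_subset[of "{x<..y}" "{x..y}"])
  then obtain z where z: "z \<in> {x<..y}" "\<forall>b\<in>{x<..y}. b \<le> z \<longrightarrow> z = b"
    using finite_has_minimal[of "{x<..y}"] assms(2) by auto
  then have "x \<lessdot> z"
    unfolding covered_by_def by (auto dest: less_imp_le intro: order_trans)
  with z that show thesis by auto
qed

text \<open>Climb from \<open>x\<close> to an upper cover \<open>z\<close> below \<open>y\<close>.
  The interval \<open>{z..y}\<close> loses at least \<open>x\<close>, so its cardinality drops and
  induction applies.\<close>

lemma locally_finite_const_le:
  fixes x y :: "'l::order"
  assumes lf: "locally_finite TYPE('l)"
    and cov: "\<And>x y. x \<lessdot> y \<Longrightarrow> f x = f y"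
    and "x \<le> y"
  shows "f x = f y"
  using \<open>x \<le> y\<close>
proof (induction "card {x..y}" arbitrary: x rule: less_induct)
  case less
  show ?case
  proof (cases "x = y")
    case False
    then obtain z where z: "x \<lessdot> z" "z \<le> y"
      using less.prems locally_finite_upper_cover[OF lf, of x y] by (auto simp: less_le)
    then have "x < z" by (simp add: covered_by_def)
    then have "x \<notin> {z..y}" "x \<in> {x..y}" "{z..y} \<subseteq> {x..y}"
      using less.prems by auto
    then have "{z..y} \<subset> {x..y}" by blast
    then have "card {z..y} < card {x..y}"
      using lf by (auto simp: locally_finite_def intro: psubset_card_mono)
    then show ?thesis using less.hyps[of z] z cov by simp
  qed simp
qed

text \<open>Incomparable elements are linked through their common upper bound
  \<open>sup x y\<close>.\<close>

lemma locally_finite_const: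
  fixes x y :: "'l::lattice"
  assumes "locally_finite TYPE('l)" and "\<And>x y. x \<lessdot> y \<Longrightarrow> f x = f y"
  shows "f x = f y"
proof -
  have le: "f u = f v" if "u \<le> v" for u v
    using locally_finite_const_le[of f, OF assms that] .
  show ?thesis using le[of x "sup x y"] le[of y "sup x y"] by simp
qed

text \<open>Abstracts the inclusion of a slice into the product, so that both factors inherit the
  Fomin axioms through the same argument.\<close>

locale cover_embedding =
  fixes e :: "'k::lattice \<Rightarrow> 'l::lattice"
  assumes inj: "inj e"
    and inf: "e (inf x y) = inf (e x) (e y)"
    and sup: "e (sup x y) = sup (e x) (e y)"
    and covered_by_iff: "e x \<lessdot> e y \<longleftrightarrow> x \<lessdot> y"
begin

lemma le_iff: "e x \<le> e y \<longleftrightarrow> x \<le> y"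
  by (metis inf inf.absorb_iff1 inj injD)

lemma modular_lattice:
  assumes "modular_lattice TYPE('l)"
  shows "modular_lattice TYPE('k)"
  unfolding modular_lattice_def
proof (intro allI impI)
  fix x y z :: 'k
  assume "x \<le> z"
  then have "e (sup x (inf y z)) = e (inf (sup x y) z)"
    using assms by (simp add: modular_lattice_def inf sup le_iff)
  then show "sup x (inf y z) = inf (sup x y) z"
    by (rule injD[OF inj])
qed

lemma locally_finite:
  assumes "locally_finite TYPE('l)"
  shows "locally_finite TYPE('k)"
  unfolding locally_finite_def
proof (intro allI)
  fix x y :: 'k
  have "e ` {x..y} \<subseteq> {e x..e y}" by (auto simp: le_iff)
  then have "finite (e ` {x..y})"
    by (rule finite_subset) (use assms in \<open>simp add: locally_finite_def\<close>)
  then show "finite {x..y}"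
    by (rule finite_imageD) (rule inj_on_subset[OF inj subset_UNIV])
qed

lemma finite_covers:
  assumes "finite_covers TYPE('l)"
  shows "finite_covers TYPE('k)"
  unfolding finite_covers_def
proof (intro allI conjI)
  fix x :: 'k
  \<comment> \<open>By \<open>covered_by_iff\<close> these preimages are exactly the sets of upper
    and lower covers of \<open>x\<close>.\<close>
  have "finite (e -` {z. e x \<lessdot> z})" "finite (e -` {z. z \<lessdot> e x})"
    using assms by (simp_all only: finite_covers_def finite_vimageI[OF _ inj])
  then show "finite {z. x \<lessdot> z}" "finite {y. y \<lessdot> x}"
    by (simp_all add: covered_by_iff)
qed

lemma projective_constant:
  assumes "projective_constant w"
  shows "projective_constant (\<lambda>x y. w (e x) (e y))"
  unfolding projective_constant_def
proof (intro allI impI)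
  fix x y :: 'k
  assume "x \<lessdot> sup x y \<and> y \<lessdot> sup x y \<and> inf x y \<lessdot> x \<and> inf x y \<lessdot> y"
  then have "e x \<lessdot> sup (e x) (e y) \<and> e y \<lessdot> sup (e x) (e y)
      \<and> inf (e x) (e y) \<lessdot> e x \<and> inf (e x) (e y) \<lessdot> e y"
    by (simp add: covered_by_iff flip: inf sup)
  with assms show "w (e (inf x y)) (e x) = w (e y) (e (sup x y))
      \<and> w (e (inf x y)) (e y) = w (e x) (e (sup x y))"
    unfolding projective_constant_def inf sup by blast
qed

text \<open>The differential condition does not simply restrict, because \<open>e x\<close> may have
  covers outside the image of \<open>e\<close>. Hence it enters as a hypothesis, with its own degree
  \<open>s\<close>.\<close>

lemma fomin_lattice:
  fixes scale :: "'r::{ring,monoid_mult} \<Rightarrow> 'v::ab_group_add \<Rightarrow> 'v"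
  assumes "fomin_lattice scale r w"
    and "\<And>x. (\<Sum>z | x \<lessdot> z. w (e x) (e z)) - (\<Sum>y | y \<lessdot> x. w (e y) (e x)) = s"
  shows "fomin_lattice scale s (\<lambda>x y. w (e x) (e y))"
proof -
  interpret F: fomin_lattice scale r w by fact
  show ?thesis
  proof unfold_locales
    fix x
    show "(\<Sum>y | y \<lessdot> x. w (e y) (e x)) + s = (\<Sum>z | x \<lessdot> z. w (e x) (e z))"
      by (simp flip: assms(2)[of x])
  qed (intro modular_lattice locally_finite finite_covers projective_constant
      F.modular F.locally_finite F.finite_covers F.projective_constant)+
qed

end

lemma cover_embedding_fst: "cover_embedding (\<lambda>x. (x, z))"
  by unfold_locales (auto simp: inj_on_def covered_by_Pair_iff covered_by_irrefl)

lemma cover_embedding_snd: "cover_embedding (Pair v)"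
  by unfold_locales (auto simp: inj_on_def covered_by_Pair_iff covered_by_irrefl)

text \<open>The corners \<open>(y, z)\<close> and \<open>(x, z')\<close> have join
  \<open>(y, z')\<close> and meet \<open>(x, z)\<close>, and all four sides are coverings.\<close>

lemma projective_constant_square:
  fixes w :: "'l1::lattice \<times> 'l2::lattice \<Rightarrow> 'l1 \<times> 'l2 \<Rightarrow> 'v"
  assumes "projective_constant w" "x \<lessdot> y" "z \<lessdot> z'"
  shows "w (x, z) (y, z) = w (x, z') (y, z')" "w (x, z) (x, z') = w (y, z) (y, z')"
proof -
  have "x \<le> y" "z \<le> z'" using assms by (auto simp: covered_by_def)
  then have "sup (y, z) (x, z') = (y, z')" "inf (y, z) (x, z') = (x, z)"
    by (auto simp: sup_absorb1 sup_absorb2 inf_absorb1 inf_absorb2)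
  then show "w (x, z) (y, z) = w (x, z') (y, z')" "w (x, z) (x, z') = w (y, z) (y, z')"
    using assms(1)[unfolded projective_constant_def, rule_format, of "(y, z)" "(x, z')"] assms(2,3)
    by (simp_all add: covered_by_Pair_iff)
qed

theorem theorem2p8:
  fixes scale :: "'r::{ring,monoid_mult} \<Rightarrow> 'v::ab_group_add \<Rightarrow> 'v"
    and r :: 'v
    and w :: "'l1::lattice \<times> 'l2::lattice \<Rightarrow> 'l1 \<times> 'l2 \<Rightarrow> 'v"
  assumes "fomin_lattice scale r w"
  shows "\<exists>(r1 :: 'v) (r2 :: 'v) (w1 :: 'l1 \<Rightarrow> 'l1 \<Rightarrow> 'v) (w2 :: 'l2 \<Rightarrow> 'l2 \<Rightarrow> 'v).
    fomin_lattice scale r1 w1 \<and>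
    fomin_lattice scale r2 w2 \<and>
    r = r1 + r2 \<and>
    (\<forall>x y z. x \<lessdot> y \<longrightarrow> w (x, z) (y, z) = w1 x y) \<and>
    (\<forall>v x y. x \<lessdot> y \<longrightarrow> w (v, x) (v, y) = w2 x y)"
proof -
  interpret F: fomin_lattice scale r w by fact
  \<comment> \<open>Arbitrary base points, available because types are inhabited. They select the
    slices on which \<open>w1\<close> and \<open>w2\<close> are read off.\<close>
  fix x0 :: 'l1 and z0 :: 'l2
  interpret E1: cover_embedding "\<lambda>x. (x, z0)" by (rule cover_embedding_fst)
  interpret E2: cover_embedding "Pair x0" by (rule cover_embedding_snd)
  define w1 where "w1 x y = w (x, z0) (y, z0)" for x y
  define w2 where "w2 x y = w (x0, x) (x0, y)" for x y
  have lf1: "locally_finite TYPE('l1)" and lf2: "locally_finite TYPE('l2)"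
    using E1.locally_finite E2.locally_finite F.locally_finite by auto
  have fc: "finite {a. x \<lessdot> a}" "finite {a. a \<lessdot> x}" "finite {b. z \<lessdot> b}" "finite {b. b \<lessdot> z}"
    for x :: 'l1 and z :: 'l2
    using E1.finite_covers[OF F.finite_covers] E2.finite_covers[OF F.finite_covers]
    by (auto simp: finite_covers_def)
  \<comment> \<open>Only for coverings, since \<open>w\<close> is arbitrary on other pairs. For
    fixed \<open>x \<lessdot> y\<close> the square lemma gives constancy along coverings in
    \<open>z\<close>.\<close>
  have w1: "w (x, z) (y, z) = w1 x y" if "x \<lessdot> y" for x y z
    unfolding w1_def
    by (rule locally_finite_const[OF lf2, where f = "\<lambda>z. w (x, z) (y, z)"])
      (rule projective_constant_square(1)[OF F.projective_constant that])
  have w2: "w (v, x) (v, y) = w2 x y" if "x \<lessdot> y" for v x y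
    unfolding w2_def
    by (rule locally_finite_const[OF lf1, where f = "\<lambda>v. w (v, x) (v, y)"])
      (rule projective_constant_square(2)[OF F.projective_constant _ that])
  define D1 where "D1 x = (\<Sum>z | x \<lessdot> z. w1 x z) - (\<Sum>y | y \<lessdot> x. w1 y x)" for x
  define D2 where "D2 x = (\<Sum>z | x \<lessdot> z. w2 x z) - (\<Sum>y | y \<lessdot> x. w2 y x)" for x
  have D: "D1 x + D2 z = r" for x z
  proof -
    \<comment> \<open>Each cover of \<open>(x, z)\<close> changes exactly one coordinate, so the sum
      splits into one part per factor.\<close>
    have "(\<Sum>q | (x, z) \<lessdot> q. w (x, z) q) = (\<Sum>a | x \<lessdot> a. w1 x a) + (\<Sum>b | z \<lessdot> b. w2 z b)"
      unfolding upper_covers_Pair by (subst sum_slices) (auto simp: fc covered_by_irrefl w1 w2)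
    moreover have
      "(\<Sum>q | q \<lessdot> (x, z). w q (x, z)) = (\<Sum>a | a \<lessdot> x. w1 a x) + (\<Sum>b | b \<lessdot> z. w2 b z)"
      unfolding lower_covers_Pair by (subst sum_slices) (auto simp: fc covered_by_irrefl w1 w2)
    ultimately show ?thesis
      using F.differential[of "(x, z)"] unfolding D1_def D2_def by (simp add: algebra_simps)
  qed
  \<comment> \<open>Hold one argument of \<open>D\<close> at its base point and cancel the common
    summand.\<close>
  have D1: "D1 x = D1 x0" and D2: "D2 z = D2 z0" for x z
    using D[of x z0] D[of x0 z0] D[of x0 z] by (metis add_right_cancel, metis add_left_cancel)
  \<comment> \<open>The degrees are the constant values of \<open>D1\<close> and \<open>D2\<close>,
    taken at the base points, where \<open>D\<close> gives their sum as \<open>r\<close>.\<close>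
  have "fomin_lattice scale (D1 x0) w1"
    using E1.fomin_lattice[OF assms, of "D1 x0"] D1 unfolding D1_def w1_def by blast
  moreover have "fomin_lattice scale (D2 z0) w2"
    using E2.fomin_lattice[OF assms, of "D2 z0"] D2 unfolding D2_def w2_def by blast
  ultimately show ?thesis
    using D[of x0 z0] w1 w2 by metis
qed

end
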